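(* Let $\{\theta_i(t)\}_{i=1}^N$ be a global-in-time classical solution of the all-to-all time-delayed Kuramoto system $$\dot\theta_i(t)=\Omega_i+\frac{\kappa}{N-1}\sum_{k\neq i}\sin(\theta_k(t-\tau_{ik})-\theta_i(t)),\quad i=1,\dots,N,\ t>0,$$ with initial data $\theta_i=\theta_i^0$ on $[-\tau,0]$. Assume $D_\theta(0)<\pi$. Let $\zeta,\xi,d_\infty,\eta$ be real numbers such that $D_\theta(0)<\zeta<\xi<\pi$, $$0<d_\infty<\min\left\{\frac{\pi}{2},d_\theta(0)\right\},\qquad \eta>\max\left\{\frac{1}{\sin\xi},\frac{1}{\cos(R_\omega\tau)},\frac{2}{1-\frac{\zeta}{\xi}}\right\},$$ and put $$\beta:=1-\frac{2}{\eta},\qquad c:=\frac{\left(\sum_{j=1}^{N-1}\eta^jP(2N,j)+1\right)\xi}{\sin\xi}.$$ Assume that $$\tan(R_\omega\tau)<\frac{\beta d_\infty}{\left(1+\frac{\zeta}{\zeta-D_\theta(0)}\right)2(N-1)c},\qquad d_\infty+R_\omega\tau<\frac{\pi}{2},$$ $$\kappa>\left(1+\frac{\zeta}{\zeta-D_\theta(0)}\right)\frac{\left(D(\Omega)+2\kappa\sin(R_\omega\tau)\right)(N-1)c}{2\cos(R_\omega\tau)}\,\frac{1}{\beta d_\infty}.$$ Then the oscillators achieve asymptotic complete frequency synchronization (i.e. $\lim_{t\to\infty}d_\omega(t)=0$) exponentially fast. More precisely, $$d_\omega(t)\le \mathcal C e^{-\tilde\gamma t}\quad\text{for all }t\ge0,$$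 where $\tilde\gamma$ and $\mathcal C$ are positive constants depending on $R_\omega$, $\kappa$ and $\tau$.
   Context: $N\ge 2$ is an integer, $\Omega_i\in\mathbb R$ are the natural frequencies, $\kappa>0$ is the coupling strength, $\tau_{ij}>0$ for $i\ne j$ are time delays, $\tau_{ii}=0$, $\tau:=\max_{i,j}\tau_{ij}$. The initial data satisfy $\theta_i^0\in C^1_b(-\tau,0)\cap C[-\tau,0]$. Notation: $\omega_i(t):=\dot\theta_i(t)$, with $\omega_i(0):=\lim_{t\to0-}\dot\theta_i(t)$; $d_\theta(t):=\max_{i,j}|\theta_i(t)-\theta_j(t)|$; $d_\omega(t):=\max_{i,j}|\omega_i(t)-\omega_j(t)|$; $D(\Omega):=\max_{i,j}|\Omega_i-\Omega_j|$; $D_\theta(0):=\max_{i,j}\max_{s,t\in[-\tau,0]}|\theta_i(s)-\theta_j(t)|$; $R_\omega:=\max_{1\le i\le N}|\Omega_i|+\kappa$; $P(m,k):=\frac{m!}{(m-k)!}$.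
   Formalization: The bound with a constant depending only on R_ω, κ, τ is proved for t>0; for all t≥0 the same rate holds with a constant that may also depend on the initial data, since ω_i(0), the left limit of the initial derivative, is not controlled by R_ω, κ, τ. *)

theory Defs
  imports "HOL-Analysis.Analysis"
begin

text \<open>
  Oscillators are indexed by {1..N}; \<open>\<theta> i t\<close> is the phase of oscillator \<open>i\<close> at time \<open>t\<close>, and only
  times from minus the largest delay onwards are relevant.
\<close>

definition max_delay :: "nat \<Rightarrow> (nat \<Rightarrow> nat \<Rightarrow> real) \<Rightarrow> real" where
  "max_delay N \<tau> = Max ((\<lambda>(i, j). \<tau> i j) ` ({1..N} \<times> {1..N}))"

definition max_spread :: "nat \<Rightarrow> (nat \<Rightarrow> real) \<Rightarrow> real" where
  "max_spread N x = Max ((\<lambda>(i, j). \<bar>x i - x j\<bar>) ` ({1..N} \<times> {1..N}))"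

definition phase_diam :: "nat \<Rightarrow> (nat \<Rightarrow> real \<Rightarrow> real) \<Rightarrow> real \<Rightarrow> real" where
  "phase_diam N \<theta> t = max_spread N (\<lambda>i. \<theta> i t)"

text \<open>
  At time 0 the frequency is, by convention, the left limit of the derivative of the initial data;
  the value there is unspecified if that limit does not exist.
\<close>

definition frequency :: "(nat \<Rightarrow> real \<Rightarrow> real) \<Rightarrow> nat \<Rightarrow> real \<Rightarrow> real" where
  "frequency \<theta> i t = (if t = 0 then Lim (at_left 0) (deriv (\<theta> i)) else deriv (\<theta> i) t)"

definition freq_diam :: "nat \<Rightarrow> (nat \<Rightarrow> real \<Rightarrow> real) \<Rightarrow> real \<Rightarrow> real" where
  "freq_diam N \<theta> t = max_spread N (\<lambda>i. frequency \<theta> i t)"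

text \<open>The supremum below is a maximum whenever the phases are continuous on \<open>{-T..0}\<close>.\<close>

definition initial_diam :: "nat \<Rightarrow> real \<Rightarrow> (nat \<Rightarrow> real \<Rightarrow> real) \<Rightarrow> real" where
  "initial_diam N T \<theta> = Sup {\<bar>\<theta> i s - \<theta> j t\<bar> | i j s t.
     i \<in> {1..N} \<and> j \<in> {1..N} \<and> s \<in> {-T..0} \<and> t \<in> {-T..0}}"

definition freq_bound :: "nat \<Rightarrow> (nat \<Rightarrow> real) \<Rightarrow> real \<Rightarrow> real" where
  "freq_bound N \<Omega> \<kappa> = Max ((\<lambda>i. \<bar>\<Omega> i\<bar>) ` {1..N}) + \<kappa>"

definition num_perms :: "nat \<Rightarrow> nat \<Rightarrow> real" where
  "num_perms m k = fact m / fact (m - k)"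

text \<open>The class of bounded \<open>C\<^sup>1\<close> functions on the open interval that are continuous on the closed one.\<close>

definition admissible_initial_datum :: "real \<Rightarrow> (real \<Rightarrow> real) \<Rightarrow> bool" where
  "admissible_initial_datum T \<phi> \<longleftrightarrow>
     continuous_on {-T..0} \<phi> \<and>
     (\<forall>t\<in>{-T<..<0}. \<phi> differentiable (at t)) \<and>
     continuous_on {-T<..<0} (deriv \<phi>) \<and>
     bounded (deriv \<phi> ` {-T<..<0})"

text \<open>
  Continuity of the derivative for positive times is automatic from the equation, since the
  phases are continuous on \<open>{-T..}\<close>.
\<close>

definition delayed_kuramoto_solution ::
  "nat \<Rightarrow> (nat \<Rightarrow> real) \<Rightarrow> real \<Rightarrow> (nat \<Rightarrow> nat \<Rightarrow> real) \<Rightarrow>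
   (nat \<Rightarrow> real \<Rightarrow> real) \<Rightarrow> (nat \<Rightarrow> real \<Rightarrow> real) \<Rightarrow> bool" where
  "delayed_kuramoto_solution N \<Omega> \<kappa> \<tau> \<theta>\<^sub>0 \<theta> \<longleftrightarrow>
     (\<forall>i\<in>{1..N}.
        continuous_on {- max_delay N \<tau>..} (\<theta> i) \<and>
        (\<forall>t\<in>{- max_delay N \<tau>..0}. \<theta> i t = \<theta>\<^sub>0 i t) \<and>
        (\<forall>t>0. (\<theta> i has_real_derivative
           \<Omega> i + \<kappa> / (real N - 1) * (\<Sum>k\<in>{1..N} - {i}. sin (\<theta> k (t - \<tau> i k) - \<theta> i t))) (at t)))"

end

theory Submission
  imports Defs
begin

text \<open>
  The hypotheses say that the delay \<open>T\<close> is tiny compared with \<open>1 / R\<close> and that the coupling is strong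
  compared with the spread of the natural frequencies. The system is then a small perturbation of
  identical, undelayed, all-to-all coupled oscillators whose phases lie in an open half circle, and it is
  treated as such in two stages.
  
  Phases. Let \<open>m\<close> be the largest phase difference, attained by \<open>i\<close> and \<open>j\<close>. Because coupling is all-to-all,
  every oscillator draws \<open>i\<close> and \<open>j\<close> together by at least \<open>sin m\<close>, so that after time \<open>T\<close> \<open>m\<close> decreases at rate at least
  \<open>\<kappa> sin m - D - 2 \<kappa> R T\<close>, where \<open>D\<close> is the spread of the natural frequencies
  (\<open>extreme_velocity_difference_le\<close>). By concavity of the sine, \<open>sin m \<ge> m sin \<xi> / \<xi>\<close> for \<open>m \<le> \<xi>\<close>. Hence phase
  differences stay below \<open>\<xi>\<close> and fall below \<open>1 / 2\<close> (\<open>phase_differences_contract\<close>).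
  
  Frequencies. From then on, differentiating the equation shows that the frequencies perform a delayed
  linear averaging with weights at least \<open>1 / 2\<close>. Without delay, frequency differences would decay at rate
  at least \<open>\<kappa> / 2\<close>. As \<open>\<kappa> T\<close> is small, the frequencies change little during a delay, and the rate \<open>\<kappa> / 4\<close> survives
  (\<open>velocity_differences_decay\<close>).
  
  The constants may depend on \<open>R\<close>, \<open>\<kappa>\<close> and \<open>T\<close> only. The rate \<open>\<kappa> / 4\<close> does; what needs an argument is the
  length of the first stage, which is governed by \<open>\<kappa> sin \<xi> / \<xi>\<close>. Here the smallness of the delay is read in
  the reverse direction: it forces \<open>R T \<le> sin \<xi> / \<xi>\<close>, so a time of order \<open>1 / (\<kappa> R T)\<close> suffices. The
  numerical consequences of the hypotheses are collected in \<open>parameter_consequences\<close>.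
  
  Differential inequalities for largest differences are obtained by a first-contact argument
  (\<open>strict_barrier\<close>) that treats the finitely many pairs of oscillators simultaneously.
\<close>

section \<open>Barriers for finite families of functions\<close>

text \<open>
  If the family ever reached \<open>g\<close>, there would be a first such time, because the family is finite and the
  set of times in question is closed. So it suffices to exclude a contact at a time \<open>t\<close> under the
  knowledge that the entire family stayed strictly below \<open>g\<close> before \<open>t\<close>. With delays this is the right
  form of induction: the behaviour at \<open>t\<close> is controlled by the history of all members, and no
  derivative of a maximum of functions has to be formed.
\<close>
lemma strict_barrier:
  fixes f :: "'p \<Rightarrow> real \<Rightarrow> real"
  assumes "finite P"
    and f_cont: "\<And>p. p \<in> P \<Longrightarrow> continuous_on {a..} (f p)"
    and g_cont: "continuous_on {a..} g"
    and start: "\<And>p. p \<in> P \<Longrightarrow> f p a < g a"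
    and no_contact: "\<And>t p. \<lbrakk>a < t; \<And>q s. \<lbrakk>q \<in> P; a \<le> s; s < t\<rbrakk> \<Longrightarrow> f q s < g s;
                \<And>q. q \<in> P \<Longrightarrow> f q t \<le> g t; p \<in> P\<rbrakk> \<Longrightarrow> f p t \<noteq> g t"
    and "p \<in> P" "a \<le> t"
  shows "f p t < g t"
proof (rule ccontr)
  assume "\<not> f p t < g t"
  define B where "B = (\<Union>q\<in>P. {s \<in> {a..}. g s \<le> f q s})"
  have closed_B: "closed B"
    unfolding B_def using \<open>finite P\<close> 
    by (intro closed_UN ballI continuous_on_closed_Collect_le f_cont g_cont) auto
  have "t \<in> B"
    using \<open>\<not> f p t < g t\<close> assms(6,7) by (auto simp: B_def intro!: bexI[of _ p])
  moreover have bdd: "bdd_below B"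
    by (rule bdd_belowI[of _ a]) (auto simp: B_def)
  ultimately have "Inf B \<in> B"
    using closed_contains_Inf[OF _ _ closed_B] by auto
  define r where "r = Inf B"
  obtain q where q: "q \<in> P" "a \<le> r" "g r \<le> f q r"
    using \<open>Inf B \<in> B\<close> by (auto simp: B_def r_def)
  have before: "f q' s < g s" if "q' \<in> P" "a \<le> s" "s < r" for q' s
    using that cInf_lower[OF _ bdd, of s] by (force simp: B_def r_def)
  have "a < r"
    using q start[of q] by (cases "a = r") auto
  have at_r: "f q' r \<le> g r" if "q' \<in> P" for q'
  proof (rule tendsto_le)
    show "at_left r \<noteq> bot" by simp
    have within: "at_left r = at r within {a..r}"
      using \<open>a < r\<close> by (simp add: at_within_Icc_at_left)
    have *: "continuous_on {a..} h \<Longrightarrow> (h \<longlongrightarrow> h r) (at_left r)" for h :: "real \<Rightarrow> real"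
      unfolding within using \<open>a \<le> r\<close>
      by (auto simp: continuous_on_def intro: tendsto_within_subset)
    show "(f q' \<longlongrightarrow> f q' r) (at_left r)" "(g \<longlongrightarrow> g r) (at_left r)"
      using * f_cont[OF that] g_cont by auto
    show "\<forall>\<^sub>F s in at_left r. f q' s \<le> g s"
      unfolding eventually_at_left[OF \<open>a < r\<close>]
      using before[OF that] \<open>a < r\<close> by (intro exI[of _ a]) (auto intro: less_imp_le)
  qed
  show False
    using no_contact[OF \<open>a < r\<close> before at_r \<open>q \<in> P\<close>] at_r q by (simp add: order_antisym)
qed

text \<open>
  A function that touches a barrier from below arrives there at least as steeply as the barrier.
\<close>
lemma contact_deriv_le:
  fixes f g :: "real \<Rightarrow> real"
  assumes f: "(f has_real_derivative f') (at t)" and g: "(g has_real_derivative g') (at t)"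
    and "a < t" and below: "\<And>s. a \<le> s \<Longrightarrow> s < t \<Longrightarrow> f s \<le> g s" and "f t = g t"
  shows "g' \<le> f'"
proof (rule ccontr)
  assume "\<not> g' \<le> f'"
  then have "((\<lambda>s. f s - g s) has_real_derivative f' - g') (at t)" "f' - g' < 0"
    using DERIV_diff[OF f g] by auto
  from DERIV_neg_dec_left[OF this] obtain e where e: "e > 0"
    "\<And>h. h > 0 \<Longrightarrow> h < e \<Longrightarrow> f t - g t < f (t - h) - g (t - h)" by blast
  define h where "h = min (e / 2) (t - a)"
  have "0 < h" "h < e" "a \<le> t - h" "t - h < t"
    using \<open>a < t\<close> \<open>e > 0\<close> by (auto simp: h_def)
  then show False using e(2)[of h] below[of "t - h"] \<open>f t = g t\<close> by auto
qed

section \<open>Mean-field sums and trigonometric estimates\<close>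

text \<open>
  The common core of both contraction estimates. Think of \<open>u k\<close> and \<open>v k\<close> as the pulls of oscillator \<open>k\<close>
  on the foremost oscillator \<open>i\<close> and on the hindmost oscillator \<open>j\<close>, of \<open>p k\<close> and \<open>q k\<close> as the same pulls
  without delay, and of \<open>e\<close> as the error caused by the delay. If each \<open>k\<close> draws \<open>i\<close> and \<open>j\<close> together by at
  least \<open>m\<close>, then the \<open>N\<close> contributions, normalised by \<open>N - 1\<close>, draw them together by at least \<open>\<kappa> m\<close>,
  up to an error \<open>\<kappa> e\<close> for each of the two. The bound does not depend on \<open>N\<close>, which is what makes the
  final rate independent of \<open>N\<close>.
\<close>
lemma pairwise_coupling_bound:
  fixes p q u v :: "nat \<Rightarrow> real"
  assumes "2 \<le> N" "0 \<le> \<kappa>" "0 \<le> m" and ij: "i \<in> {1..N}" "j \<in> {1..N}"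
    and u: "\<And>k. k \<in> {1..N} - {i} \<Longrightarrow> u k \<le> p k + e"
    and v: "\<And>k. k \<in> {1..N} - {j} \<Longrightarrow> q k - e \<le> v k"
    and "p i = 0" "q j = 0"
    and pq: "\<And>k. k \<in> {1..N} \<Longrightarrow> p k - q k \<le> - m"
  shows "\<kappa> / (real N - 1) * (\<Sum>k\<in>{1..N} - {i}. u k)
         - \<kappa> / (real N - 1) * (\<Sum>k\<in>{1..N} - {j}. v k) \<le> \<kappa> * (2 * e - m)"
proof -
  have card: "real (card ({1..N} - {l})) = real N - 1" if "l \<in> {1..N}" for l
    using that by (simp add: of_nat_diff)
  have drop: "(\<Sum>k\<in>{1..N} - {l}. h k) = (\<Sum>k\<in>{1..N}. h k)" if "l \<in> {1..N}" "h l = 0"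
    for l and h :: "nat \<Rightarrow> real"
    using that by (simp add: sum_diff1)
  have "(\<Sum>k\<in>{1..N} - {i}. u k) \<le> (\<Sum>k\<in>{1..N} - {i}. p k + e)"
    by (rule sum_mono) (rule u)
  also have "\<dots> = (\<Sum>k\<in>{1..N}. p k) + (real N - 1) * e"
    using drop[of i p] card[of i] ij \<open>p i = 0\<close> by (simp only: sum.distrib sum_constant)
  finally have 1: "(\<Sum>k\<in>{1..N} - {i}. u k) \<le> (\<Sum>k\<in>{1..N}. p k) + (real N - 1) * e" .
  have "(\<Sum>k\<in>{1..N}. q k) - (real N - 1) * e = (\<Sum>k\<in>{1..N} - {j}. q k - e)"
    using drop[of j q] card[of j] ij \<open>q j = 0\<close> by (simp only: sum_subtractf sum_constant)
  also have "\<dots> \<le> (\<Sum>k\<in>{1..N} - {j}. v k)"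
    by (rule sum_mono) (rule v)
  finally have 2: "(\<Sum>k\<in>{1..N}. q k) - (real N - 1) * e \<le> (\<Sum>k\<in>{1..N} - {j}. v k)" .
  have "(\<Sum>k\<in>{1..N}. p k) - (\<Sum>k\<in>{1..N}. q k) \<le> (\<Sum>k\<in>{1..N}. - m)"
    unfolding sum_subtractf[symmetric] by (rule sum_mono) (rule pq)
  also have "\<dots> \<le> - ((real N - 1) * m)"
    using \<open>0 \<le> m\<close> by (simp add: algebra_simps)
  finally have "(\<Sum>k\<in>{1..N} - {i}. u k) - (\<Sum>k\<in>{1..N} - {j}. v k) \<le> (real N - 1) * (2 * e - m)"
    using 1 2 by (simp add: algebra_simps)
  then have "\<kappa> / (real N - 1) * ((\<Sum>k\<in>{1..N} - {i}. u k) - (\<Sum>k\<in>{1..N} - {j}. v k))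
      \<le> \<kappa> / (real N - 1) * ((real N - 1) * (2 * e - m))"
    using assms(1,2) by (intro mult_left_mono) auto
  then show ?thesis
    using \<open>2 \<le> N\<close> by (simp add: right_diff_distrib)
qed

lemma abs_coupling_le:
  fixes x :: "nat \<Rightarrow> real"
  assumes "2 \<le> N" "0 \<le> \<kappa>" "i \<in> {1..N}"
    and x: "\<And>k. k \<in> {1..N} - {i} \<Longrightarrow> \<bar>x k\<bar> \<le> B"
  shows "\<bar>\<kappa> / (real N - 1) * (\<Sum>k\<in>{1..N} - {i}. x k)\<bar> \<le> \<kappa> * B"
proof -
  have "\<bar>\<Sum>k\<in>{1..N} - {i}. x k\<bar> \<le> (\<Sum>k\<in>{1..N} - {i}. \<bar>x k\<bar>)"
    by (rule sum_abs)
  also have "\<dots> \<le> (\<Sum>k\<in>{1..N} - {i}. B)"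
    by (rule sum_mono) (rule x)
  also have "\<dots> = (real N - 1) * B"
    using assms(1,3) by (simp add: of_nat_diff)
  finally have "\<kappa> / (real N - 1) * \<bar>\<Sum>k\<in>{1..N} - {i}. x k\<bar> \<le> \<kappa> / (real N - 1) * ((real N - 1) * B)"
    using assms(1,2) by (intro mult_left_mono) auto
  then show ?thesis
    using assms(1,2) by (simp add: abs_mult)
qed

lemma abs_sin_diff_le: "\<bar>sin x - sin y\<bar> \<le> \<bar>x - y\<bar>" for x y :: real
proof -
  have "\<bar>sin x - sin y\<bar> = 2 * \<bar>sin ((x - y) / 2)\<bar> * \<bar>cos ((x + y) / 2)\<bar>"
    by (simp add: sin_diff_sin abs_mult)
  also have "\<dots> \<le> 2 * \<bar>(x - y) / 2\<bar> * 1"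
    by (intro mult_mono abs_sin_x_le_abs_x) auto
  finally show ?thesis by simp
qed

lemma sin_add_le_sin_plus_sin:
  fixes a b :: real
  assumes "0 \<le> a" "0 \<le> b" "a + b \<le> pi"
  shows "sin (a + b) \<le> sin a + sin b"
proof -
  have "0 \<le> sin a" "0 \<le> sin b"
    using assms by (auto intro!: sin_ge_zero)
  then have "sin a * cos b \<le> sin a * 1" "cos a * sin b \<le> 1 * sin b"
    using mult_left_mono[of "cos b" 1 "sin a"] mult_right_mono[of "cos a" 1 "sin b"] by auto
  then show ?thesis by (simp add: sin_add)
qed

text \<open>
  The sine is concave on \<open>{0..pi}\<close>, so it lies above the chord from \<open>0\<close> to \<open>\<xi>\<close>. The slope \<open>sin \<xi> / \<xi>\<close> of
  this chord is the linear restoring rate of the coupling as long as phase differences stay below \<open>\<xi>\<close>.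
\<close>
lemma sin_ge_chord:
  fixes x \<xi> :: real
  assumes "0 \<le> x" "x \<le> \<xi>" "0 < \<xi>" "\<xi> \<le> pi"
  shows "sin \<xi> / \<xi> * x \<le> sin x"
proof -
  have "concave_on {0..pi} (sin :: real \<Rightarrow> real)"
    by (rule f''_le0_imp_concave[where f' = cos and f'' = "\<lambda>x. - sin x"])
       (auto intro!: derivative_eq_intros sin_ge_zero)
  from concave_onD[OF this, of "x / \<xi>" 0 \<xi>] assms show ?thesis by (simp add: field_simps)
qed

text \<open>
  By the mean value theorem, since the derivative \<open>1 / cos\<^sup>2\<close> of the tangent is at least \<open>1\<close>.
\<close>
lemma self_le_tan:
  fixes x :: real
  assumes "0 < x" "x < pi / 2"
  shows "x \<le> tan x"
proof -
  have pos: "cos y > 0" if "0 \<le> y" "y \<le> x" for y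
    using that assms by (intro cos_gt_zero_pi) auto
  have "\<exists>z. 0 < z \<and> z < x \<and> tan x - tan 0 = (x - 0) * inverse ((cos z)\<^sup>2)"
    using \<open>0 < x\<close> pos by (intro MVT2 DERIV_tan) (auto simp: less_imp_neq[symmetric])
  then obtain z where z: "0 < z" "z < x" "tan x = x * inverse ((cos z)\<^sup>2)" by auto
  have "1 \<le> inverse ((cos z)\<^sup>2)"
    using pos[of z] z by (intro one_le_inverse) (auto simp: power_le_one)
  then show ?thesis
    using z \<open>0 < x\<close> by simp
qed

section \<open>Oscillators with delayed all-to-all coupling\<close>

text \<open>
  The numbers \<open>T\<close>, \<open>R\<close> and \<open>D\<close> are upper bounds for the delays, for the speeds and for the differences of
  the natural frequencies. The estimates below start at time \<open>T\<close>, when all delayed arguments lie in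
  \<open>{0..}\<close> and the initial data, whose speed \<open>R\<close> does not bound, have dropped out.
\<close>
locale delayed_oscillators =
  fixes N :: nat and \<Omega> :: "nat \<Rightarrow> real" and \<kappa> :: real and \<tau> :: "nat \<Rightarrow> nat \<Rightarrow> real"
    and \<theta> :: "nat \<Rightarrow> real \<Rightarrow> real" and T R D :: real
  assumes N_ge_2: "2 \<le> N" and \<kappa>_pos: "0 < \<kappa>" and T_pos: "0 < T"
    and delay_nonneg: "\<lbrakk>i \<in> {1..N}; j \<in> {1..N}\<rbrakk> \<Longrightarrow> 0 \<le> \<tau> i j"
    and delay_le: "\<lbrakk>i \<in> {1..N}; j \<in> {1..N}\<rbrakk> \<Longrightarrow> \<tau> i j \<le> T"
    and speed_le: "i \<in> {1..N} \<Longrightarrow> \<bar>\<Omega> i\<bar> + \<kappa> \<le> R"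
    and spread_le: "\<lbrakk>i \<in> {1..N}; j \<in> {1..N}\<rbrakk> \<Longrightarrow> \<Omega> i - \<Omega> j \<le> D"
    and phase_continuous: "i \<in> {1..N} \<Longrightarrow> continuous_on {0..} (\<theta> i)"
    and phase_equation: "\<lbrakk>i \<in> {1..N}; 0 < t\<rbrakk> \<Longrightarrow> (\<theta> i has_real_derivative
       \<Omega> i + \<kappa> / (real N - 1) * (\<Sum>k\<in>{1..N} - {i}. sin (\<theta> k (t - \<tau> i k) - \<theta> i t))) (at t)"
begin

definition velocity :: "nat \<Rightarrow> real \<Rightarrow> real" where
  "velocity i t = \<Omega> i + \<kappa> / (real N - 1) * (\<Sum>k\<in>{1..N} - {i}. sin (\<theta> k (t - \<tau> i k) - \<theta> i t))"

definition acceleration :: "nat \<Rightarrow> real \<Rightarrow> real" where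
  "acceleration i t = \<kappa> / (real N - 1) * (\<Sum>k\<in>{1..N} - {i}.
     cos (\<theta> k (t - \<tau> i k) - \<theta> i t) * (velocity k (t - \<tau> i k) - velocity i t))"

lemma R_pos: "0 < R"
  using speed_le[of 1] \<kappa>_pos N_ge_2 by auto

lemma phase_deriv: "\<lbrakk>i \<in> {1..N}; 0 < t\<rbrakk> \<Longrightarrow> (\<theta> i has_real_derivative velocity i t) (at t)"
  unfolding velocity_def by (rule phase_equation)

lemma abs_velocity_le:
  assumes "i \<in> {1..N}"
  shows "\<bar>velocity i t\<bar> \<le> R"
proof -
  have "\<bar>\<kappa> / (real N - 1) * (\<Sum>k\<in>{1..N} - {i}. sin (\<theta> k (t - \<tau> i k) - \<theta> i t))\<bar> \<le> \<kappa> * 1"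
    using N_ge_2 \<kappa>_pos assms by (intro abs_coupling_le) auto
  then show ?thesis
    using speed_le[OF assms] unfolding velocity_def by linarith
qed

lemma phase_lipschitz:
  assumes "i \<in> {1..N}" "0 \<le> s" "s \<le> t"
  shows "\<bar>\<theta> i s - \<theta> i t\<bar> \<le> R * (t - s)"
proof (cases "s = t")
  case False
  then have "s < t" using assms by simp
  then obtain z where z: "\<theta> i t - \<theta> i s = velocity i z * (t - s)"
  proof (rule mvt)
    show "continuous_on {s..t} (\<theta> i)"
      using phase_continuous[OF assms(1)] by (rule continuous_on_subset) (use assms in auto)
    show "(\<theta> i has_derivative (*) (velocity i x)) (at x)" if "s < x" for x
      using phase_deriv[OF assms(1), of x] that assms by (simp add: has_field_derivative_def)
  qed
  have "\<bar>velocity i z\<bar> * (t - s) \<le> R * (t - s)"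
    using abs_velocity_le[OF assms(1)] \<open>s < t\<close> by (intro mult_right_mono) auto
  then show ?thesis
    using z \<open>s < t\<close> by (simp add: abs_minus_commute[of "\<theta> i s"] abs_mult)
qed simp

lemma phase_lag_le:
  assumes "i \<in> {1..N}" "k \<in> {1..N}" "T \<le> t"
  shows "\<bar>\<theta> k (t - \<tau> i k) - \<theta> k t\<bar> \<le> R * T"
proof -
  have "\<bar>\<theta> k (t - \<tau> i k) - \<theta> k t\<bar> \<le> R * \<tau> i k"
    using phase_lipschitz[of k "t - \<tau> i k" t] delay_nonneg[of i k] delay_le[of i k] assms by simp
  also have "\<dots> \<le> R * T"
    using delay_le[of i k] R_pos assms by simp
  finally show ?thesis .
qed

text \<open>
  For the undelayed coupling and oscillators \<open>i\<close>, \<open>j\<close> at maximal distance \<open>m\<close>, every \<open>k\<close> lies between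
  them and splits \<open>m\<close> into two non-negative parts \<open>a + b\<close>; as \<open>sin a + sin b \<ge> sin (a + b)\<close>, it draws \<open>i\<close> and
  \<open>j\<close> together by at least \<open>sin m\<close>. Since phases move at speed at most \<open>R\<close>, the delay changes each pull by
  at most \<open>R * T\<close>.
\<close>
lemma extreme_velocity_difference_le:
  assumes ij: "i \<in> {1..N}" "j \<in> {1..N}" and "T \<le> t"
    and extreme: "\<And>k l. \<lbrakk>k \<in> {1..N}; l \<in> {1..N}\<rbrakk> \<Longrightarrow> \<theta> k t - \<theta> l t \<le> m"
    and m: "\<theta> i t - \<theta> j t = m" "m \<le> pi"
  shows "velocity i t - velocity j t \<le> D + \<kappa> * (2 * (R * T) - sin m)"
proof -
  have "0 \<le> m" using extreme[of i i] ij by simp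
  have lag: "\<bar>sin (\<theta> k (t - \<tau> l k) - \<theta> l t) - sin (\<theta> k t - \<theta> l t)\<bar> \<le> R * T"
    if "k \<in> {1..N}" "l \<in> {1..N}" for k l
    using abs_sin_diff_le[of "\<theta> k (t - \<tau> l k) - \<theta> l t" "\<theta> k t - \<theta> l t"]
      phase_lag_le[OF that(2,1) \<open>T \<le> t\<close>] by simp
  have "\<kappa> / (real N - 1) * (\<Sum>k\<in>{1..N} - {i}. sin (\<theta> k (t - \<tau> i k) - \<theta> i t))
      - \<kappa> / (real N - 1) * (\<Sum>k\<in>{1..N} - {j}. sin (\<theta> k (t - \<tau> j k) - \<theta> j t))
      \<le> \<kappa> * (2 * (R * T) - sin m)"
  proof (rule pairwise_coupling_bound[where p = "\<lambda>k. sin (\<theta> k t - \<theta> i t)"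
        and q = "\<lambda>k. sin (\<theta> k t - \<theta> j t)"])
    show "0 \<le> sin m" using \<open>0 \<le> m\<close> m by (intro sin_ge_zero)
    show "sin (\<theta> k (t - \<tau> i k) - \<theta> i t) \<le> sin (\<theta> k t - \<theta> i t) + R * T"
      if "k \<in> {1..N} - {i}" for k
      using lag[of k i] that ij by (simp add: abs_le_iff)
    show "sin (\<theta> k t - \<theta> j t) - R * T \<le> sin (\<theta> k (t - \<tau> j k) - \<theta> j t)"
      if "k \<in> {1..N} - {j}" for k
      using lag[of k j] that ij by (simp add: abs_le_iff)
    show "sin (\<theta> k t - \<theta> i t) - sin (\<theta> k t - \<theta> j t) \<le> - sin m" if "k \<in> {1..N}" for k
    proof -
      have "sin (\<theta> i t - \<theta> k t + (\<theta> k t - \<theta> j t))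
          \<le> sin (\<theta> i t - \<theta> k t) + sin (\<theta> k t - \<theta> j t)"
        using extreme[of i k] extreme[of k i] extreme[of k j] extreme[of j k] m that ij
        by (intro sin_add_le_sin_plus_sin) auto
      moreover have "sin (\<theta> i t - \<theta> k t) = - sin (\<theta> k t - \<theta> i t)"
        by (simp flip: sin_minus)
      ultimately show ?thesis using m by simp
    qed
  qed (use N_ge_2 \<kappa>_pos ij in auto)
  then show ?thesis
    using spread_le[OF ij] unfolding velocity_def by linarith
qed

text \<open>
  Comparison principle for the phase diameter. The hypothesis \<open>contact\<close> only concerns times at which the
  barrier is touched, so that a bound already known for the phase differences may be used for \<open>g t\<close>.
\<close>
lemma phase_barrier:
  assumes g: "\<And>t. T \<le> t \<Longrightarrow> (g has_real_derivative g' t) (at t)"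
    and start: "\<And>i j. \<lbrakk>i \<in> {1..N}; j \<in> {1..N}\<rbrakk> \<Longrightarrow> \<theta> i T - \<theta> j T < g T"
    and contact: "\<And>t i j. \<lbrakk>T < t; i \<in> {1..N}; j \<in> {1..N}; \<theta> i t - \<theta> j t = g t\<rbrakk>
      \<Longrightarrow> g t \<le> pi \<and> D + \<kappa> * (2 * (R * T) - sin (g t)) < g' t"
    and ij: "i \<in> {1..N}" "j \<in> {1..N}" and "T \<le> t"
  shows "\<theta> i t - \<theta> j t < g t"
proof -
  define f where "f = (\<lambda>(i, j) t. \<theta> i t - \<theta> j t)"
  have "f (i, j) t < g t"
  proof (rule strict_barrier[where P = "{1..N} \<times> {1..N}" and a = T and f = f and g = g])
    show "continuous_on {T..} (f p)" if "p \<in> {1..N} \<times> {1..N}" for p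
    proof -
      have "continuous_on {T..} (\<theta> k)" if "k \<in> {1..N}" for k
        using phase_continuous[OF that] by (rule continuous_on_subset) (use T_pos in auto)
      then show ?thesis using that by (auto simp: f_def intro!: continuous_on_diff)
    qed
    show "continuous_on {T..} g"
      using g by (intro continuous_at_imp_continuous_on) (auto intro: DERIV_isCont)
    show "f p T < g T" if "p \<in> {1..N} \<times> {1..N}" for p
      using that start by (auto simp: f_def)
    show "f p t \<noteq> g t" if "T < t"
      and before: "\<And>q s. \<lbrakk>q \<in> {1..N} \<times> {1..N}; T \<le> s; s < t\<rbrakk> \<Longrightarrow> f q s < g s"
      and at: "\<And>q. q \<in> {1..N} \<times> {1..N} \<Longrightarrow> f q t \<le> g t" and p: "p \<in> {1..N} \<times> {1..N}" for p t
    proof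
      assume eq: "f p t = g t"
      obtain k l where kl: "p = (k, l)" "k \<in> {1..N}" "l \<in> {1..N}" using p by auto
      have "0 < t" using \<open>T < t\<close> T_pos by simp
      have "((\<lambda>t. \<theta> k t - \<theta> l t) has_real_derivative velocity k t - velocity l t) (at t)"
        using kl \<open>0 < t\<close> by (intro DERIV_diff phase_deriv)
      then have "g' t \<le> velocity k t - velocity l t"
      proof (rule contact_deriv_le[where a = T and g = g])
        show "(g has_real_derivative g' t) (at t)" using g \<open>T < t\<close> by simp
        show "\<theta> k s - \<theta> l s \<le> g s" if "T \<le> s" "s < t" for s
          using before[OF p that] kl by (simp add: f_def less_imp_le)
        show "\<theta> k t - \<theta> l t = g t" using eq kl by (simp add: f_def)
      qed (rule \<open>T < t\<close>)
      also have "\<dots> \<le> D + \<kappa> * (2 * (R * T) - sin (g t))"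
      proof (rule extreme_velocity_difference_le)
        show "\<theta> k' t - \<theta> l' t \<le> g t" if "k' \<in> {1..N}" "l' \<in> {1..N}" for k' l'
          using at[of "(k', l')"] that by (simp add: f_def)
        show "\<theta> k t - \<theta> l t = g t" using eq kl by (simp add: f_def)
        then show "g t \<le> pi" using contact[OF \<open>T < t\<close> kl(2,3)] by blast
      qed (use kl \<open>T < t\<close> in auto)
      also have "\<dots> < g' t"
        using contact[OF \<open>T < t\<close> kl(2,3)] eq kl by (simp add: f_def)
      finally show False by simp
    qed
  qed (use ij \<open>T \<le> t\<close> in auto)
  then show ?thesis by (simp add: f_def)
qed

text \<open>
  The velocity involves the phases delayed by up to \<open>T\<close>, which are differentiable only at positive times;
  hence the velocities are differentiable from time \<open>T\<close> on, and by the same argument the accelerations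
  are continuous from time \<open>2 * T\<close> on.
\<close>
lemma velocity_deriv:
  assumes i: "i \<in> {1..N}" and t: "T < t"
  shows "(velocity i has_real_derivative acceleration i t) (at t)"
proof -
  have "((\<lambda>t. sin (\<theta> k (t - \<tau> i k) - \<theta> i t)) has_real_derivative
      cos (\<theta> k (t - \<tau> i k) - \<theta> i t) * (velocity k (t - \<tau> i k) - velocity i t)) (at t)"
    if "k \<in> {1..N}" for k
  proof -
    have "0 < t - \<tau> i k" "0 < t" using delay_le[of i k] i that t T_pos by auto
    then have "((\<lambda>t. \<theta> k (t - \<tau> i k)) has_real_derivative velocity k (t - \<tau> i k)) (at t)"
      using phase_deriv[OF that, of "t - \<tau> i k"] DERIV_shift[of "\<theta> k" _ t "- \<tau> i k"] by simp
    from DERIV_diff[OF this phase_deriv[OF i \<open>0 < t\<close>]]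
    show ?thesis by (rule DERIV_fun_sin)
  qed
  then have "((\<lambda>t. \<Omega> i + \<kappa> / (real N - 1) *
        (\<Sum>k\<in>{1..N} - {i}. sin (\<theta> k (t - \<tau> i k) - \<theta> i t)))
      has_real_derivative 0 + acceleration i t) (at t)"
    unfolding acceleration_def by (intro DERIV_add DERIV_const DERIV_cmult DERIV_sum) auto
  then show ?thesis by (simp only: velocity_def[abs_def] add_0)
qed

lemma velocity_continuous:
  assumes i: "i \<in> {1..N}"
  shows "continuous_on {T..} (velocity i)"
proof -
  have "continuous_on {T..} (\<lambda>t. \<theta> k (t - \<tau> l k))" if "k \<in> {1..N}" "l \<in> {1..N}" for k l
    using delay_le[of l k] that
    by (intro continuous_on_compose2[OF phase_continuous[OF that(1)]] continuous_intros) auto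
  moreover have "continuous_on {T..} (\<theta> k)" if "k \<in> {1..N}" for k
    using phase_continuous[OF that] by (rule continuous_on_subset) (use T_pos in auto)
  ultimately show ?thesis
    unfolding velocity_def[abs_def] using i by (intro continuous_intros) auto
qed

lemma acceleration_continuous:
  assumes i: "i \<in> {1..N}"
  shows "continuous_on {2 * T..} (acceleration i)"
proof -
  have "continuous_on {2 * T..} (\<lambda>t. \<theta> k (t - \<tau> i k))" if "k \<in> {1..N}" for k
    using delay_le[of i k] that i T_pos
    by (intro continuous_on_compose2[OF phase_continuous[OF that(1)]] continuous_intros) auto
  moreover have "continuous_on {2 * T..} (\<lambda>t. velocity k (t - \<tau> i k))" if "k \<in> {1..N}" for k
    using delay_le[of i k] that i T_pos
    by (intro continuous_on_compose2[OF velocity_continuous[OF that(1)]] continuous_intros) auto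
  moreover have "continuous_on {2 * T..} (\<theta> k)" "continuous_on {2 * T..} (velocity k)"
    if "k \<in> {1..N}" for k
    using phase_continuous[OF that] velocity_continuous[OF that] T_pos
    by (auto elim!: continuous_on_subset)
  ultimately show ?thesis
    unfolding acceleration_def[abs_def] using i by (intro continuous_intros) auto
qed

lemma abs_acceleration_le:
  assumes "i \<in> {1..N}"
    and "\<And>k. k \<in> {1..N} \<Longrightarrow> \<bar>velocity k (t - \<tau> i k) - velocity i t\<bar> \<le> B"
  shows "\<bar>acceleration i t\<bar> \<le> \<kappa> * B"
  unfolding acceleration_def
proof (rule abs_coupling_le)
  fix k assume "k \<in> {1..N} - {i}"
  then have "\<bar>cos (\<theta> k (t - \<tau> i k) - \<theta> i t)\<bar> * \<bar>velocity k (t - \<tau> i k) - velocity i t\<bar> \<le> 1 * B"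
    using assms(2)[of k] by (intro mult_mono) auto
  then show "\<bar>cos (\<theta> k (t - \<tau> i k) - \<theta> i t) * (velocity k (t - \<tau> i k) - velocity i t)\<bar> \<le> B"
    by (simp add: abs_mult)
qed (use N_ge_2 \<kappa>_pos assms in auto)

text \<open>
  While the delayed phase differences are at most \<open>1 < pi / 3\<close>, the velocities follow a linear averaging dynamics
  with weights \<open>cos (\<dots>) \<ge> 1 / 2\<close>: each \<open>k\<close> draws the extreme velocities together by at least \<open>m / 2\<close>,
  up to the error \<open>e\<close> made by using delayed velocities.
\<close>
lemma extreme_acceleration_difference_le:
  assumes ij: "i \<in> {1..N}" "j \<in> {1..N}"
    and close: "\<And>k l. \<lbrakk>k \<in> {1..N}; l \<in> {1..N}\<rbrakk> \<Longrightarrow> \<bar>\<theta> k (t - \<tau> l k) - \<theta> l t\<bar> \<le> 1"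
    and lag: "\<And>k l. \<lbrakk>k \<in> {1..N}; l \<in> {1..N}\<rbrakk> \<Longrightarrow> \<bar>velocity k (t - \<tau> l k) - velocity k t\<bar> \<le> e"
    and extreme: "\<And>k l. \<lbrakk>k \<in> {1..N}; l \<in> {1..N}\<rbrakk> \<Longrightarrow> velocity k t - velocity l t \<le> m"
    and m: "velocity i t - velocity j t = m"
  shows "acceleration i t - acceleration j t \<le> \<kappa> * (2 * e - m / 2)"
  unfolding acceleration_def
proof (rule pairwise_coupling_bound[where p = "\<lambda>k. (velocity k t - velocity i t) / 2"
      and q = "\<lambda>k. (velocity k t - velocity j t) / 2"])
  let ?c = "\<lambda>k l. cos (\<theta> k (t - \<tau> l k) - \<theta> l t)"
  have c: "1 / 2 \<le> ?c k l" if "k \<in> {1..N}" "l \<in> {1..N}" for k l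
  proof -
    have "cos (pi / 3) \<le> cos \<bar>\<theta> k (t - \<tau> l k) - \<theta> l t\<bar>"
      using close[OF that] pi_gt3 by (intro cos_monotone_0_pi_le) auto
    then show ?thesis by (simp add: cos_60)
  qed
  have err: "\<bar>?c k l * (velocity k (t - \<tau> l k) - velocity k t)\<bar> \<le> e"
    if "k \<in> {1..N}" "l \<in> {1..N}" for k l
  proof -
    have "\<bar>?c k l\<bar> * \<bar>velocity k (t - \<tau> l k) - velocity k t\<bar> \<le> 1 * e"
      using lag[OF that] by (intro mult_mono) auto
    then show ?thesis by (simp add: abs_mult)
  qed
  have split: "?c k l * (velocity k (t - \<tau> l k) - velocity l t)
    = ?c k l * (velocity k t - velocity l t) + ?c k l * (velocity k (t - \<tau> l k) - velocity k t)" for k l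
    by (simp add: algebra_simps)
  show "0 \<le> m / 2" using extreme[of i i] ij by simp
  show "?c k i * (velocity k (t - \<tau> i k) - velocity i t) \<le> (velocity k t - velocity i t) / 2 + e"
    if "k \<in> {1..N} - {i}" for k
  proof -
    have "?c k i * (velocity k t - velocity i t) \<le> 1 / 2 * (velocity k t - velocity i t)"
      using c[of k i] that ij extreme[of k j] m by (intro mult_right_mono_neg) auto
    moreover have "\<bar>?c k i * (velocity k (t - \<tau> i k) - velocity k t)\<bar> \<le> e"
      using that ij by (intro err) auto
    ultimately show ?thesis using split[of k i] unfolding abs_le_iff by linarith
  qed
  show "(velocity k t - velocity j t) / 2 - e \<le> ?c k j * (velocity k (t - \<tau> j k) - velocity j t)"
    if "k \<in> {1..N} - {j}" for k
  proof -
    have "1 / 2 * (velocity k t - velocity j t) \<le> ?c k j * (velocity k t - velocity j t)"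
      using c[of k j] that ij extreme[of i k] m by (intro mult_right_mono) auto
    moreover have "\<bar>?c k j * (velocity k (t - \<tau> j k) - velocity k t)\<bar> \<le> e"
      using that ij by (intro err) auto
    ultimately show ?thesis using split[of k j] unfolding abs_le_iff by linarith
  qed
  show "(velocity k t - velocity i t) / 2 - (velocity k t - velocity j t) / 2 \<le> - (m / 2)" for k
    unfolding m[symmetric] by (simp add: field_simps)
qed (use N_ge_2 \<kappa>_pos ij in auto)

section \<open>The phases gather within half a radian\<close>

text \<open>
  At the value \<open>\<xi>\<close> the attraction \<open>\<kappa> sin \<xi>\<close> exceeds the heterogeneity and the delay error, so \<open>\<xi>\<close> itself is
  a barrier.
\<close>
lemma phase_differences_confined:
  assumes "0 < \<xi>" "\<xi> \<le> pi"
    and start: "\<And>i j. \<lbrakk>i \<in> {1..N}; j \<in> {1..N}\<rbrakk> \<Longrightarrow> \<theta> i T - \<theta> j T < \<xi>"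
    and small: "D + 2 * \<kappa> * (R * T) < \<kappa> * sin \<xi>"
    and "i \<in> {1..N}" "j \<in> {1..N}" "T \<le> t"
  shows "\<theta> i t - \<theta> j t < \<xi>"
proof (rule phase_barrier[where g = "\<lambda>_. \<xi>" and g' = "\<lambda>_. 0"])
  show "\<xi> \<le> pi \<and> D + \<kappa> * (2 * (R * T) - sin \<xi>) < 0"
    using assms(2) small by (simp add: algebra_simps)
qed (use assms in auto)

text \<open>
  Below \<open>\<xi>\<close> the attraction is at least linear with rate \<open>\<kappa> sin \<xi> / \<xi>\<close>, so phase differences decay
  exponentially towards a level proportional to heterogeneity and delay error, here at most \<open>1 / 3\<close>. The
  barrier starts at a value above \<open>pi > \<xi>\<close> and decays with the smaller rate \<open>\<kappa> R T\<close>: the rate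
  \<open>\<kappa> sin \<xi> / \<xi>\<close> would depend on \<open>\<xi>\<close>, whereas the entrance time into the region of small phase differences
  has to be bounded in terms of \<open>\<kappa>\<close>, \<open>R\<close> and \<open>T\<close> alone.
\<close>
lemma phase_differences_contract:
  assumes \<xi>: "0 < \<xi>" "\<xi> < pi"
    and start: "\<And>i j. \<lbrakk>i \<in> {1..N}; j \<in> {1..N}\<rbrakk> \<Longrightarrow> \<theta> i T - \<theta> j T < \<xi>"
    and small: "D + 2 * \<kappa> * (R * T) < \<kappa> * sin \<xi>"
      "D + 2 * \<kappa> * (R * T) < \<kappa> * (sin \<xi> / \<xi>) / 3" "R * T \<le> sin \<xi> / \<xi>"
    and ij: "i \<in> {1..N}" "j \<in> {1..N}" and "T \<le> t"
  shows "\<theta> i t - \<theta> j t < 1 / 3 + 4 * exp (- (\<kappa> * (R * T)) * (t - T))"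
proof (rule phase_barrier[where g' = "\<lambda>t. 4 * (exp (- (\<kappa> * (R * T)) * (t - T)) * - (\<kappa> * (R * T)))"])
  define g where "g t = 1 / 3 + 4 * exp (- (\<kappa> * (R * T)) * (t - T))" for t
  define \<sigma> where "\<sigma> = sin \<xi> / \<xi>"
  show "((\<lambda>t. 1 / 3 + 4 * exp (- (\<kappa> * (R * T)) * (t - T))) has_real_derivative
      4 * (exp (- (\<kappa> * (R * T)) * (t - T)) * - (\<kappa> * (R * T)))) (at t)" for t
    by (auto intro!: derivative_eq_intros)
  show "\<theta> k T - \<theta> l T < 1 / 3 + 4 * exp (- (\<kappa> * (R * T)) * (T - T))"
    if "k \<in> {1..N}" "l \<in> {1..N}" for k l
    using start[OF that] \<xi> pi_less_4 by simp
  fix t k l assume t: "T < t" and kl: "k \<in> {1..N}" "l \<in> {1..N}"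
    and eq: "\<theta> k t - \<theta> l t = 1 / 3 + 4 * exp (- (\<kappa> * (R * T)) * (t - T))"
  have "g t < \<xi>"
    using phase_differences_confined[OF \<xi>(1) less_imp_le[OF \<xi>(2)] start small(1) kl, of t] t eq
    by (simp add: g_def)
  have "1 / 3 \<le> g t" by (simp add: g_def)
  have "\<sigma> * g t \<le> sin (g t)"
    unfolding \<sigma>_def using \<open>g t < \<xi>\<close> \<open>1 / 3 \<le> g t\<close> \<xi> by (intro sin_ge_chord) auto
  then have "\<kappa> * (\<sigma> * g t) \<le> \<kappa> * sin (g t)"
    using \<kappa>_pos by simp
  then have "D + \<kappa> * (2 * (R * T) - sin (g t)) \<le> D + 2 * \<kappa> * (R * T) - \<kappa> * \<sigma> * g t"
    by (simp add: algebra_simps)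
  also have "\<dots> < - (\<kappa> * \<sigma>) * (g t - 1 / 3)"
    using small(2) by (simp add: \<sigma>_def algebra_simps)
  also have "\<dots> \<le> - (\<kappa> * (R * T)) * (g t - 1 / 3)"
    using mult_left_mono[OF small(3), of \<kappa>] \<kappa>_pos \<open>1 / 3 \<le> g t\<close> unfolding \<sigma>_def
    by (intro mult_right_mono) auto
  also have "\<dots> = 4 * (exp (- (\<kappa> * (R * T)) * (t - T)) * - (\<kappa> * (R * T)))"
    by (simp add: g_def)
  finally show "1 / 3 + 4 * exp (- (\<kappa> * (R * T)) * (t - T)) \<le> pi \<and>
      D + \<kappa> * (2 * (R * T) - sin (1 / 3 + 4 * exp (- (\<kappa> * (R * T)) * (t - T))))
      < 4 * (exp (- (\<kappa> * (R * T)) * (t - T)) * - (\<kappa> * (R * T)))"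
    using \<open>g t < \<xi>\<close> \<xi> by (simp add: g_def)
qed (use assms in auto)

section \<open>Exponential decay of the frequency differences\<close>
lemma \<kappa>_le_R: "\<kappa> \<le> R"
  using speed_le[of 1] N_ge_2 by auto

lemma velocity_difference_le: "\<lbrakk>i \<in> {1..N}; j \<in> {1..N}\<rbrakk> \<Longrightarrow> \<bar>velocity i s - velocity j t\<bar> \<le> 2 * R"
  using abs_velocity_le[of i s] abs_velocity_le[of j t] by linarith

lemma velocity_lag_le:
  assumes ik: "i \<in> {1..N}" "k \<in> {1..N}" and "2 * T < t"
    and bound: "\<And>s. \<lbrakk>t - T \<le> s; s < t\<rbrakk> \<Longrightarrow> \<bar>acceleration k s\<bar> \<le> B"
  shows "\<bar>velocity k (t - \<tau> i k) - velocity k t\<bar> \<le> T * B"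
proof -
  have "0 \<le> B" using bound[of "t - T"] T_pos by simp
  show ?thesis
  proof (cases "\<tau> i k = 0")
    case False
    then have lt: "t - \<tau> i k < t" using delay_nonneg[OF ik] by simp
    have late: "T < t - \<tau> i k" using delay_le[OF ik] \<open>2 * T < t\<close> by simp
    from lt obtain z where z: "t - \<tau> i k < z" "z < t"
      "velocity k t - velocity k (t - \<tau> i k) = acceleration k z * (t - (t - \<tau> i k))"
    proof (rule mvt)
      show "continuous_on {t - \<tau> i k..t} (velocity k)"
        using velocity_continuous[OF ik(2)] by (rule continuous_on_subset) (use late in auto)
      show "(velocity k has_derivative (*) (acceleration k x)) (at x)" if "t - \<tau> i k < x" for x
        using velocity_deriv[OF ik(2), of x] that late by (simp add: has_field_derivative_def)
    qed
    have "\<bar>velocity k (t - \<tau> i k) - velocity k t\<bar> = \<tau> i k * \<bar>acceleration k z\<bar>"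
      using z(3) delay_nonneg[OF ik] by (simp add: abs_minus_commute abs_mult)
    also have "\<dots> \<le> T * B"
      using bound[of z] z delay_nonneg[OF ik] delay_le[OF ik] T_pos
      by (intro mult_mono) auto
    finally show ?thesis .
  qed (use \<open>0 \<le> B\<close> T_pos in simp)
qed

text \<open>
  The delay error in the averaging dynamics is an integral of accelerations over a time at most \<open>T\<close>, and
  accelerations are in turn bounded by velocity differences. To close this circle, velocity differences
  and accelerations are kept below one exponential barrier simultaneously, the accelerations
  with the weight \<open>1 / (2 * \<kappa>)\<close>. At a contact of a velocity difference with the barrier \<open>g\<close>, the delay error is
  at most \<open>2 \<kappa> T \<cdot> (21 / 20) g \<le> (7 / 60) g\<close>, so the difference decreases at rate at
  least \<open>\<kappa> (1 / 2 - 2 \<cdot> 7 / 60)\<close>, more than the rate \<open>\<kappa> / 4\<close> of the barrier. An acceleration does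
  not reach the barrier because it is at most \<open>\<kappa> (1 + 7 / 60) g < 2 \<kappa> g\<close>.
\<close>
lemma velocity_differences_decay:
  assumes "2 * T \<le> a" and RT: "R * T \<le> 1 / 18"
    and close: "\<And>t k l. \<lbrakk>a \<le> t; k \<in> {1..N}; l \<in> {1..N}\<rbrakk> \<Longrightarrow> \<theta> k t - \<theta> l t \<le> 1 / 2"
    and ij: "i \<in> {1..N}" "j \<in> {1..N}" and "a \<le> t"
  shows "velocity i t - velocity j t < 3 * R * exp (- (\<kappa> / 4) * (t - a))"
proof -
  define g where "g t = 3 * R * exp (- (\<kappa> / 4) * (t - a))" for t
  define f where "f = case_sum (\<lambda>(i, j) t. velocity i t - velocity j t) (\<lambda>i t. \<bar>acceleration i t\<bar> / (2 * \<kappa>))"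
  define P where "P = ({1..N} \<times> {1..N}) <+> {1..N}"
  have members: "\<lbrakk>k \<in> {1..N}; l \<in> {1..N}\<rbrakk> \<Longrightarrow> Inl (k, l) \<in> P" "k \<in> {1..N} \<Longrightarrow> Inr k \<in> P" for k l
    by (auto simp: P_def)
  have g_pos: "0 < g t" for t
    using R_pos by (simp add: g_def)
  have g_deriv: "(g has_real_derivative - (\<kappa> / 4) * g t) (at t)" for t
    unfolding g_def by (auto intro!: derivative_eq_intros)
  have \<kappa>T: "\<kappa> * T \<le> 1 / 18"
    using mult_right_mono[OF \<kappa>_le_R, of T] T_pos RT by linarith
  have g_before: "g s \<le> 21 / 20 * g t" if "t - T \<le> s" for s t
  proof -
    have "\<kappa> / 4 * (t - s) \<le> \<kappa> / 4 * T"
      using that \<kappa>_pos by (intro mult_left_mono) auto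
    then have "exp (\<kappa> / 4 * (t - s)) \<le> exp (1 / 72)"
      using \<kappa>T by simp
    also have "\<dots> \<le> 21 / 20"
      using exp_bound[of "1 / 72"] by (simp add: power2_eq_square)
    finally have "exp (\<kappa> / 4 * (t - s)) * g t \<le> 21 / 20 * g t"
      using g_pos[of t] by (intro mult_right_mono) auto
    moreover have "exp (\<kappa> / 4 * (t - s)) * g t = g s"
    proof -
      have "exp (\<kappa> / 4 * (t - s)) * exp (- (\<kappa> / 4) * (t - a)) = exp (- (\<kappa> / 4) * (s - a))"
        by (simp add: right_diff_distrib flip: exp_add)
      then show ?thesis unfolding g_def by (simp only: mult_ac)
    qed
    ultimately show ?thesis by simp
  qed
  have crude: "\<bar>acceleration k s\<bar> \<le> \<kappa> * (2 * R)" if "k \<in> {1..N}" for k s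
    using that velocity_difference_le by (intro abs_acceleration_le) auto
  have "f (Inl (i, j)) t < g t"
  proof (rule strict_barrier[where P = P and a = a and f = f and g = g])
    show "finite P" "Inl (i, j) \<in> P" "a \<le> t"
      using ij \<open>a \<le> t\<close> by (auto simp: P_def)
    show "continuous_on {a..} (f p)" if "p \<in> P" for p
    proof -
      have "continuous_on {a..} (velocity k)" "continuous_on {a..} (acceleration k)" if "k \<in> {1..N}" for k
        using velocity_continuous[OF that] acceleration_continuous[OF that] \<open>2 * T \<le> a\<close> T_pos
        by (auto elim!: continuous_on_subset)
      then show ?thesis
        using that \<kappa>_pos by (auto simp: f_def P_def intro!: continuous_intros)
    qed
    show "continuous_on {a..} g"
      using g_deriv by (intro continuous_at_imp_continuous_on) (auto intro: DERIV_isCont)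
    show "f p a < g a" if "p \<in> P" for p
    proof -
      have "velocity k a - velocity l a < 3 * R" if "k \<in> {1..N}" "l \<in> {1..N}" for k l
        using velocity_difference_le[OF that, of a a] R_pos by simp
      moreover have "\<bar>acceleration k a\<bar> / (2 * \<kappa>) < 3 * R" if "k \<in> {1..N}" for k
      proof -
        have "\<bar>acceleration k a\<bar> / (2 * \<kappa>) \<le> \<kappa> * (2 * R) / (2 * \<kappa>)"
          using crude[OF that] \<kappa>_pos by (intro divide_right_mono) auto
        then show ?thesis using \<kappa>_pos R_pos by simp
      qed
      ultimately show ?thesis using that by (auto simp: f_def g_def P_def)
    qed
    fix t p
    assume "a < t" and before: "\<And>q s. \<lbrakk>q \<in> P; a \<le> s; s < t\<rbrakk> \<Longrightarrow> f q s < g s"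
      and at: "\<And>q. q \<in> P \<Longrightarrow> f q t \<le> g t" and "p \<in> P"
    \<comment> \<open>the barrier grows by at most the factor \<open>21 / 20\<close> over a delay; before \<open>a\<close> the crude bound on accelerations applies\<close>
    have history: "\<bar>acceleration k s\<bar> \<le> 2 * \<kappa> * (21 / 20 * g t)" if "k \<in> {1..N}" "t - T \<le> s" "s < t" for k s
    proof (cases "a \<le> s")
      case True
      have "\<bar>acceleration k s\<bar> / (2 * \<kappa>) < g s"
        using before[OF members(2)[OF that(1)] True that(3)] by (simp add: f_def)
      then have "\<bar>acceleration k s\<bar> < 2 * \<kappa> * g s"
        using \<kappa>_pos by (simp add: field_simps)
      also have "\<dots> \<le> 2 * \<kappa> * (21 / 20 * g t)"
        using g_before[OF that(2)] \<kappa>_pos by (intro mult_left_mono) auto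
      finally show ?thesis by simp
    next
      case False
      have "\<bar>acceleration k s\<bar> \<le> 2 * \<kappa> * g a"
        using crude[OF that(1), of s] mult_pos_pos[OF \<kappa>_pos R_pos] by (simp add: g_def)
      also have "\<dots> \<le> 2 * \<kappa> * (21 / 20 * g t)"
        using g_before[of t a] that(2) False \<kappa>_pos by (intro mult_left_mono) auto
      finally show ?thesis .
    qed
    have lag: "\<bar>velocity k (t - \<tau> l k) - velocity k t\<bar> \<le> 7 / 60 * g t" if "k \<in> {1..N}" "l \<in> {1..N}" for k l
    proof -
      have "\<bar>velocity k (t - \<tau> l k) - velocity k t\<bar> \<le> T * (2 * \<kappa> * (21 / 20 * g t))"
        using \<open>2 * T \<le> a\<close> \<open>a < t\<close> history[OF that(1)] that by (intro velocity_lag_le) auto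
      also have "\<dots> = \<kappa> * T * (21 / 10 * g t)" by simp
      also have "\<dots> \<le> 1 / 18 * (21 / 10 * g t)"
        using \<kappa>T g_pos[of t] by (intro mult_right_mono) auto
      finally show ?thesis by simp
    qed
    have pair: "velocity k t - velocity l t \<le> g t" if "k \<in> {1..N}" "l \<in> {1..N}" for k l
      using at[OF members(1)[OF that]] by (simp add: f_def)
    show "f p t \<noteq> g t"
    proof
      assume eq: "f p t = g t"
      consider k l where "p = Inl (k, l)" "k \<in> {1..N}" "l \<in> {1..N}" | k where "p = Inr k" "k \<in> {1..N}"
        using \<open>p \<in> P\<close> by (auto simp: P_def)
      then show False
      proof cases
        case (1 k l)
        then have contact: "velocity k t - velocity l t = g t"
          using eq by (simp add: f_def)
        have "T < t" using \<open>a < t\<close> \<open>2 * T \<le> a\<close> T_pos by simp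
        have "- (\<kappa> / 4) * g t \<le> acceleration k t - acceleration l t"
        proof (rule contact_deriv_le[where a = a and g = g])
          show "((\<lambda>t. velocity k t - velocity l t) has_real_derivative
              acceleration k t - acceleration l t) (at t)"
            using 1 \<open>T < t\<close> by (intro DERIV_diff velocity_deriv)
          show "velocity k s - velocity l s \<le> g s" if "a \<le> s" "s < t" for s
            using before[OF \<open>p \<in> P\<close> that] 1 by (simp add: f_def)
        qed (fact g_deriv \<open>a < t\<close> contact)+
        also have "\<dots> \<le> \<kappa> * (2 * (7 / 60 * g t) - g t / 2)"
        proof (rule extreme_acceleration_difference_le[OF 1(2,3) _ lag pair contact])
          show "\<bar>\<theta> k' (t - \<tau> l' k') - \<theta> l' t\<bar> \<le> 1" if "k' \<in> {1..N}" "l' \<in> {1..N}" for k' l'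
            using phase_lag_le[OF that(2,1), of t] close[of t k' l'] close[of t l' k'] that
              \<open>a < t\<close> \<open>T < t\<close> RT by (auto simp: abs_le_iff)
        qed
        \<comment> \<open>\<open>2 * 7 / 60 - 1 / 2 = - 4 / 15 < - 1 / 4\<close>\<close>
        also have "\<dots> < - (\<kappa> / 4) * g t"
          using mult_pos_pos[OF \<kappa>_pos g_pos[of t]] by (simp add: algebra_simps)
        finally show False by simp
      next
        case (2 k)
        have "\<bar>acceleration k t\<bar> \<le> \<kappa> * (67 / 60 * g t)"
        proof (rule abs_acceleration_le[OF 2(2)])
          show "\<bar>velocity k' (t - \<tau> k k') - velocity k t\<bar> \<le> 67 / 60 * g t" if "k' \<in> {1..N}" for k'
            using lag[OF that 2(2)] pair[OF that 2(2)] pair[OF 2(2) that] by linarith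
        qed
        also have "\<dots> < 2 * \<kappa> * g t"
          using mult_pos_pos[OF \<kappa>_pos g_pos[of t]] by simp
        finally have "\<bar>acceleration k t\<bar> / (2 * \<kappa>) < g t"
          using \<kappa>_pos by (simp add: field_simps)
        then show False using eq 2 by (simp add: f_def)
      qed
    qed
  qed
  then show ?thesis by (simp add: f_def g_def)
qed

text \<open>
  The time \<open>a\<close> makes \<open>4 * exp (- \<kappa> R T (a - T))\<close> at most \<open>1 / 6\<close>, hence phase differences are at most
  \<open>1 / 3 + 1 / 6 = 1 / 2\<close> from then on. Before \<open>a\<close> velocity differences are at most \<open>2 * R\<close>, which the prefactor
  absorbs.
\<close>
lemma exponential_frequency_synchronization:
  assumes \<xi>: "0 < \<xi>" "\<xi> < pi"
    and start: "\<And>i j. \<lbrakk>i \<in> {1..N}; j \<in> {1..N}\<rbrakk> \<Longrightarrow> \<theta> i T - \<theta> j T < \<xi>"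
    and small: "D + 2 * \<kappa> * (R * T) < \<kappa> * sin \<xi>"
      "D + 2 * \<kappa> * (R * T) < \<kappa> * (sin \<xi> / \<xi>) / 3" "R * T \<le> sin \<xi> / \<xi>" "R * T \<le> 1 / 18"
    and ij: "i \<in> {1..N}" "j \<in> {1..N}"
  defines "a \<equiv> 2 * T + ln 24 / (\<kappa> * (R * T))"
  shows "velocity i t - velocity j t \<le> 3 * R * exp (\<kappa> / 4 * a) * exp (- (\<kappa> / 4) * t)"
proof -
  have pos: "0 < \<kappa> * (R * T)" using \<kappa>_pos R_pos T_pos by simp
  then have a: "2 * T \<le> a" by (simp add: a_def)
  have close: "\<theta> k s - \<theta> l s \<le> 1 / 2" if "a \<le> s" "k \<in> {1..N}" "l \<in> {1..N}" for s k l
  proof -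
    have "ln 24 / (\<kappa> * (R * T)) \<le> s - T" using that(1) T_pos by (simp add: a_def)
    then have "ln 24 \<le> \<kappa> * (R * T) * (s - T)"
      using pos by (simp add: pos_divide_le_eq mult.commute)
    then have "exp (- (\<kappa> * (R * T)) * (s - T)) \<le> exp (- ln 24)" by simp
    also have "\<dots> = 1 / 24" by (simp add: exp_minus)
    finally have "1 / 3 + 4 * exp (- (\<kappa> * (R * T)) * (s - T)) \<le> 1 / 2" by simp
    moreover have "T \<le> s" using that(1) a T_pos by simp
    ultimately show ?thesis
      using phase_differences_contract[OF \<xi> start small(1,2,3) that(2,3), of s] by simp
  qed
  have combine: "3 * R * exp (\<kappa> / 4 * a) * exp (- (\<kappa> / 4) * t) = 3 * R * exp (- (\<kappa> / 4) * (t - a))"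
    by (simp add: mult.assoc right_diff_distrib flip: exp_add)
  show ?thesis
  proof (cases "a \<le> t")
    case True
    then show ?thesis
      unfolding combine using velocity_differences_decay[OF a small(4) close ij True] by simp
  next
    case False
    have "velocity i t - velocity j t \<le> 3 * R * 1"
      using velocity_difference_le[OF ij, of t t] R_pos by simp
    also have "\<dots> \<le> 3 * R * exp (- (\<kappa> / 4) * (t - a))"
      using R_pos \<kappa>_pos False by (intro mult_left_mono) (auto simp: mult_nonneg_nonpos)
    finally show ?thesis unfolding combine .
  qed
qed

end

section \<open>Diameters and the smallness hypotheses\<close>
lemma max_spread_le_iff:
  assumes "1 \<le> N"
  shows "max_spread N x \<le> B \<longleftrightarrow> (\<forall>i\<in>{1..N}. \<forall>j\<in>{1..N}. x i - x j \<le> B)"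
proof -
  have "{1..N} \<times> {1..N} \<noteq> {}" using assms by auto
  then have "max_spread N x \<le> B \<longleftrightarrow> (\<forall>i\<in>{1..N}. \<forall>j\<in>{1..N}. \<bar>x i - x j\<bar> \<le> B)"
    unfolding max_spread_def by (subst Max_le_iff) auto
  also have "\<dots> \<longleftrightarrow> (\<forall>i\<in>{1..N}. \<forall>j\<in>{1..N}. x i - x j \<le> B)"
    unfolding abs_le_iff by (metis minus_diff_eq)
  finally show ?thesis .
qed

lemma max_spread_nonneg:
  assumes "1 \<le> N"
  shows "0 \<le> max_spread N x"
proof -
  have "1 \<in> {1..N}" using assms by simp
  from bspec[OF bspec[OF iffD1[OF max_spread_le_iff[OF assms] order_refl] this] this]
  show ?thesis by simp
qed

text \<open>
  The supremum is over a bounded set, since the phases are continuous on a compact interval.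
\<close>
lemma initial_phase_difference_le:
  assumes cont: "\<And>i. i \<in> {1..N} \<Longrightarrow> continuous_on {-T..0} (\<theta> i)"
    and "i \<in> {1..N}" "j \<in> {1..N}" "s \<in> {-T..0}" "t \<in> {-T..0}"
  shows "\<bar>\<theta> i s - \<theta> j t\<bar> \<le> initial_diam N T \<theta>"
  unfolding initial_diam_def
proof (rule cSup_upper)
  show "\<bar>\<theta> i s - \<theta> j t\<bar> \<in> {\<bar>\<theta> i s - \<theta> j t\<bar> | i j s t.
     i \<in> {1..N} \<and> j \<in> {1..N} \<and> s \<in> {-T..0} \<and> t \<in> {-T..0}}"
    using assms(2-) by blast
  have "bounded (\<Union>i\<in>{1..N}. \<theta> i ` {-T..0})"
    using cont by (intro bounded_UN ballI compact_imp_bounded compact_continuous_image) auto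
  then obtain b where b: "\<And>i s. i \<in> {1..N} \<Longrightarrow> s \<in> {-T..0} \<Longrightarrow> \<bar>\<theta> i s\<bar> \<le> b"
    unfolding bounded_iff real_norm_def by blast
  have "\<bar>\<theta> k s - \<theta> l t\<bar> \<le> 2 * b"
    if "k \<in> {1..N}" "l \<in> {1..N}" "s \<in> {-T..0}" "t \<in> {-T..0}" for k l s t
    using b[OF that(1,3)] b[OF that(2,4)] by linarith
  then show "bdd_above {\<bar>\<theta> i s - \<theta> j t\<bar> | i j s t.
     i \<in> {1..N} \<and> j \<in> {1..N} \<and> s \<in> {-T..0} \<and> t \<in> {-T..0}}"
    unfolding bdd_above_def by blast
qed

text \<open>
  Here \<open>x\<close> stands for \<open>R * T\<close> and \<open>S\<close> for the spread of the natural frequencies. With \<open>\<sigma> = sin \<xi> / \<xi>\<close>, the first term of the sum in \<open>c\<close> alone gives \<open>c \<ge> (1 + \<eta> * 2 * N) / \<sigma> \<ge> 9 / \<sigma>\<close>,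
  and \<open>1 + \<zeta> / (\<zeta> - D\<^sub>0)\<close> is at least \<open>2\<close> and at least \<open>\<zeta> / (\<zeta> - D\<^sub>0)\<close>. The
  hypothesis on the delay thus becomes \<open>36 * x < d * \<sigma>\<close> and \<open>18 * x < \<zeta> - D\<^sub>0\<close>, and the hypothesis on the coupling
  becomes \<open>9 * S < \<kappa> * d * \<sigma>\<close>. Together with \<open>d < \<xi>\<close>, \<open>d < 2\<close> and \<open>\<sigma> \<le> 1\<close> these imply all the claims. In
  particular \<open>x\<close> is a lower bound for \<open>\<sigma>\<close>: this is how \<open>R\<close> and \<open>T\<close> control the contraction rate.
\<close>
lemma parameter_consequences:
  fixes N :: nat and x \<kappa> S D\<^sub>0 \<zeta> \<xi> d \<eta> \<beta> c :: real
  assumes "2 \<le> N" "0 < \<kappa>" "0 \<le> S" "0 < x" "0 \<le> D\<^sub>0"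
    and "D\<^sub>0 < \<zeta>" "\<zeta> < \<xi>" "\<xi> < pi"
    and "0 < d" "d < pi / 2" "d < D\<^sub>0"
    and \<eta>: "2 / (1 - \<zeta> / \<xi>) < \<eta>"
    and \<beta>: "\<beta> = 1 - 2 / \<eta>"
    and c: "c = ((\<Sum>j=1..N-1. \<eta> ^ j * num_perms (2 * N) j) + 1) * \<xi> / sin \<xi>"
    and tan_small: "tan x < \<beta> * d / ((1 + \<zeta> / (\<zeta> - D\<^sub>0)) * 2 * (real N - 1) * c)"
    and "d + x < pi / 2"
    and coupling: "(1 + \<zeta> / (\<zeta> - D\<^sub>0)) * ((S + 2 * \<kappa> * sin x) * (real N - 1) * c / (2 * cos x))
             * (1 / (\<beta> * d)) < \<kappa>"
  shows "D\<^sub>0 + 2 * x < \<xi>" "S + 2 * \<kappa> * x < \<kappa> * sin \<xi>"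
    and "S + 2 * \<kappa> * x < \<kappa> * (sin \<xi> / \<xi>) / 3" "x \<le> sin \<xi> / \<xi>" "x \<le> 1 / 18"
proof -
  define \<sigma> where "\<sigma> = sin \<xi> / \<xi>"
  define Z where "Z = 1 + \<zeta> / (\<zeta> - D\<^sub>0)"
  have "0 < \<zeta>" "0 < \<xi>" using assms by auto
  have sin_pos: "0 < sin \<xi>" using \<open>0 < \<xi>\<close> \<open>\<xi> < pi\<close> by (rule sin_gt_zero)
  have \<sigma>: "0 < \<sigma>" "\<sigma> \<le> 1"
    using sin_pos sin_x_le_x[of \<xi>] \<open>0 < \<xi>\<close> by (auto simp: \<sigma>_def)
  have "2 \<le> 2 / (1 - \<zeta> / \<xi>)"
    using \<open>0 < \<zeta>\<close> \<open>\<zeta> < \<xi>\<close> by (simp add: field_simps)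
  then have "2 < \<eta>" using \<eta> by simp
  then have "0 < \<beta>" "\<beta> < 1" by (auto simp: \<beta> field_simps)
  have Z: "2 \<le> Z" "\<zeta> / (\<zeta> - D\<^sub>0) \<le> Z"
    using \<open>0 \<le> D\<^sub>0\<close> \<open>D\<^sub>0 < \<zeta>\<close> by (auto simp: Z_def le_divide_eq_1_pos)
  have "num_perms (2 * N) 1 = 2 * real N"
    using fact_reduce[of "2 * N", where 'a = real] \<open>2 \<le> N\<close> by (simp add: num_perms_def)
  then have "8 \<le> \<eta> ^ 1 * num_perms (2 * N) 1"
    using mult_mono[of 2 \<eta> 4 "2 * real N"] \<open>2 < \<eta>\<close> \<open>2 \<le> N\<close> by simp
  also have "\<dots> \<le> (\<Sum>j=1..N-1. \<eta> ^ j * num_perms (2 * N) j)"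
    using \<open>2 < \<eta>\<close> \<open>2 \<le> N\<close> by (intro member_le_sum) (auto simp: num_perms_def)
  finally have "9 / \<sigma> \<le> c"
    unfolding c \<sigma>_def using sin_pos \<open>0 < \<xi>\<close> by (simp add: divide_simps)
  then have "9 / \<sigma> \<le> (real N - 1) * c"
    using mult_mono[of 1 "real N - 1" "9 / \<sigma>" c] \<open>2 \<le> N\<close> \<sigma> by simp
  define M where "M = (real N - 1) * c"
  have M: "9 / \<sigma> \<le> M" "0 < M"
    using \<open>9 / \<sigma> \<le> (real N - 1) * c\<close> \<sigma> less_le_trans[of 0 "9 / \<sigma>"] by (auto simp: M_def)
  have "0 < Z" using Z by simp
  have "x < pi / 2" using \<open>0 < d\<close> \<open>d + x < pi / 2\<close> by simp
  have "\<beta> * d < d" using \<open>\<beta> < 1\<close> \<open>0 < d\<close> by simp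
  have "x \<le> tan x" using \<open>0 < x\<close> \<open>x < pi / 2\<close> by (rule self_le_tan)
  also have "\<dots> < \<beta> * d / (Z * 2 * M)"
    using tan_small by (simp add: Z_def M_def mult.assoc)
  finally have "x * (Z * 2 * M) < \<beta> * d"
    using \<open>0 < Z\<close> M by (simp add: pos_less_divide_eq)
  also note \<open>\<beta> * d < d\<close>
  finally have "2 * (x * Z) * M < d" by (simp add: mult_ac)
  moreover have "2 * (x * Z) * (9 / \<sigma>) \<le> 2 * (x * Z) * M"
    using M \<open>0 < x\<close> \<open>0 < Z\<close> by (intro mult_left_mono) auto
  ultimately have "2 * (x * Z) * (9 / \<sigma>) < d" by linarith
  \<comment> \<open>\<open>xZ\<close> is used twice: with \<open>Z \<ge> 2\<close> to compare \<open>x\<close> with \<open>\<sigma>\<close>, with \<open>Z \<ge> \<zeta> / (\<zeta> - D\<^sub>0)\<close> to compare it with \<open>\<zeta> - D\<^sub>0\<close>\<close>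
  then have xZ: "18 * (x * Z) < d * \<sigma>"
    using \<sigma> by (simp add: field_simps)
  have "x * 2 \<le> x * Z" using Z \<open>0 < x\<close> by simp
  then have x: "36 * x < d * \<sigma>" using xZ by simp
  have "d * \<sigma> \<le> d" using \<sigma> \<open>0 < d\<close> by simp
  have "2 * x < \<zeta> - D\<^sub>0"
  proof -
    have "18 * (x * (\<zeta> / (\<zeta> - D\<^sub>0))) \<le> 18 * (x * Z)"
      using Z \<open>0 < x\<close> by (intro mult_left_mono) auto
    also have "\<dots> < \<zeta>"
      using xZ \<open>d * \<sigma> \<le> d\<close> assms by linarith
    finally have "\<zeta> * (18 * x) < \<zeta> * (\<zeta> - D\<^sub>0)"
      using \<open>D\<^sub>0 < \<zeta>\<close> by (simp add: field_simps)
    then show ?thesis using \<open>0 < \<zeta>\<close> \<open>0 < x\<close> by simp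
  qed
  then show "D\<^sub>0 + 2 * x < \<xi>" using \<open>\<zeta> < \<xi>\<close> by simp
  have S: "9 * S < \<kappa> * (d * \<sigma>)"
  proof -
    have cos_pos: "0 < cos x" using \<open>0 < x\<close> \<open>x < pi / 2\<close> by (intro cos_gt_zero_pi) auto
    have "0 \<le> sin x" using \<open>0 < x\<close> \<open>x < pi / 2\<close> by (intro sin_ge_zero) auto
    have "Z * ((S + 2 * \<kappa> * sin x) * M) / (2 * cos x * (\<beta> * d)) < \<kappa>"
      using coupling by (simp add: Z_def M_def mult.assoc)
    then have "Z * ((S + 2 * \<kappa> * sin x) * M) < \<kappa> * (2 * cos x * (\<beta> * d))"
      using cos_pos \<open>0 < \<beta>\<close> \<open>0 < d\<close> by (simp add: pos_divide_less_eq)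
    also have "\<dots> \<le> \<kappa> * (2 * 1 * d)"
      using cos_pos \<open>0 < \<beta>\<close> \<open>0 < d\<close> \<open>\<beta> * d < d\<close> \<open>0 < \<kappa>\<close>
      by (intro mult_left_mono mult_mono) auto
    finally have "Z * ((S + 2 * \<kappa> * sin x) * M) < 2 * \<kappa> * d" by simp
    moreover have "2 * (S * (9 / \<sigma>)) \<le> Z * ((S + 2 * \<kappa> * sin x) * M)"
      using Z M \<sigma> \<open>0 \<le> sin x\<close> \<open>0 \<le> S\<close> \<open>0 < \<kappa>\<close> by (intro mult_mono) auto
    ultimately have "S * (9 / \<sigma>) < \<kappa> * d" by simp
    then show ?thesis using \<sigma> by (simp add: field_simps)
  qed
  have "\<kappa> * (36 * x) < \<kappa> * (d * \<sigma>)" using x \<open>0 < \<kappa>\<close> by simp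
  then have total: "6 * (S + 2 * \<kappa> * x) < \<kappa> * (d * \<sigma>)"
    using S by (simp add: algebra_simps)
  have "\<kappa> * (d * \<sigma>) \<le> \<kappa> * (\<xi> * \<sigma>)"
    using assms \<sigma> by (intro mult_left_mono mult_right_mono) auto
  also have "\<xi> * \<sigma> = sin \<xi>" using \<open>0 < \<xi>\<close> by (simp add: \<sigma>_def)
  finally show "S + 2 * \<kappa> * x < \<kappa> * sin \<xi>"
    using total mult_pos_pos[OF \<open>0 < \<kappa>\<close> \<open>0 < x\<close>] \<open>0 \<le> S\<close> by simp
  have "\<kappa> * (d * \<sigma>) \<le> \<kappa> * (2 * \<sigma>)"
    using assms \<sigma> pi_less_4 by (intro mult_left_mono mult_right_mono) auto
  then show "S + 2 * \<kappa> * x < \<kappa> * (sin \<xi> / \<xi>) / 3"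
    unfolding \<sigma>_def[symmetric] using total by simp
  have "d * \<sigma> \<le> 2 * \<sigma>"
    using assms \<sigma> pi_less_4 by (intro mult_right_mono) auto
  then show "x \<le> sin \<xi> / \<xi>" "x \<le> 1 / 18"
    unfolding \<sigma>_def[symmetric] using x \<sigma> \<open>0 < x\<close> by linarith+
qed

section \<open>Complete frequency synchronization\<close>
theorem theorem4p1:
  "\<exists>\<gamma> C :: real \<Rightarrow> real \<Rightarrow> real \<Rightarrow> real.
     \<forall>(N :: nat) (\<Omega> :: nat \<Rightarrow> real) (\<kappa> :: real) (\<tau> :: nat \<Rightarrow> nat \<Rightarrow> real)
      (\<theta>\<^sub>0 :: nat \<Rightarrow> real \<Rightarrow> real) (\<theta> :: nat \<Rightarrow> real \<Rightarrow> real)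
      (T :: real) (R :: real) (D\<^sub>0 :: real)
      (\<zeta> :: real) (\<xi> :: real) (d :: real) (\<eta> :: real) (\<beta> :: real) (c :: real).
       2 \<le> N \<and> 0 < \<kappa> \<and>
       (\<forall>i\<in>{1..N}. \<forall>j\<in>{1..N}. i \<noteq> j \<longrightarrow> 0 < \<tau> i j) \<and> (\<forall>i\<in>{1..N}. \<tau> i i = 0) \<and>
       T = max_delay N \<tau> \<and> R = freq_bound N \<Omega> \<kappa> \<and> D\<^sub>0 = initial_diam N T \<theta> \<and>
       (\<forall>i\<in>{1..N}. admissible_initial_datum T (\<theta>\<^sub>0 i)) \<and>
       delayed_kuramoto_solution N \<Omega> \<kappa> \<tau> \<theta>\<^sub>0 \<theta> \<and>
       D\<^sub>0 < pi \<and>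
       D\<^sub>0 < \<zeta> \<and> \<zeta> < \<xi> \<and> \<xi> < pi \<and>
       0 < d \<and> d < min (pi / 2) (phase_diam N \<theta> 0) \<and>
       \<eta> > Max {1 / sin \<xi>, 1 / cos (R * T), 2 / (1 - \<zeta> / \<xi>)} \<and>
       \<beta> = 1 - 2 / \<eta> \<and>
       c = ((\<Sum>j=1..N-1. \<eta> ^ j * num_perms (2 * N) j) + 1) * \<xi> / sin \<xi> \<and>
       tan (R * T) < \<beta> * d / ((1 + \<zeta> / (\<zeta> - D\<^sub>0)) * 2 * (real N - 1) * c) \<and>
       d + R * T < pi / 2 \<and>
       \<kappa> > (1 + \<zeta> / (\<zeta> - D\<^sub>0)) *
             ((max_spread N \<Omega> + 2 * \<kappa> * sin (R * T)) * (real N - 1) * c / (2 * cos (R * T))) *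
             (1 / (\<beta> * d))
       \<longrightarrow>
       (freq_diam N \<theta> \<longlongrightarrow> 0) at_top \<and>
       0 < \<gamma> R \<kappa> T \<and> 0 < C R \<kappa> T \<and>
       (\<forall>t>0. freq_diam N \<theta> t \<le> C R \<kappa> T * exp (- \<gamma> R \<kappa> T * t)) \<and>
       (\<exists>C'>0. \<forall>t\<ge>0. freq_diam N \<theta> t \<le> C' * exp (- \<gamma> R \<kappa> T * t))"
proof (rule exI[of _ "\<lambda>R \<kappa> T. \<kappa> / 4"],
    rule exI[of _ "\<lambda>R \<kappa> T. 3 * R * exp (\<kappa> / 4 * (2 * T + ln 24 / (\<kappa> * (R * T))))"],
    intro allI impI, elim conjE)
  fix N \<Omega> \<kappa> \<tau> \<theta>\<^sub>0 \<theta> T R D\<^sub>0 \<zeta> \<xi> d \<eta> \<beta> c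
  assume "2 \<le> N" "0 < \<kappa>"
    and delays: "\<forall>i\<in>{1..N}. \<forall>j\<in>{1..N}. i \<noteq> j \<longrightarrow> 0 < \<tau> i j" "\<forall>i\<in>{1..N}. \<tau> i i = 0"
    and T: "T = max_delay N \<tau>" and R: "R = freq_bound N \<Omega> \<kappa>" and D\<^sub>0: "D\<^sub>0 = initial_diam N T \<theta>"
    and solution: "delayed_kuramoto_solution N \<Omega> \<kappa> \<tau> \<theta>\<^sub>0 \<theta>"
    and parameters: "D\<^sub>0 < \<zeta>" "\<zeta> < \<xi>" "\<xi> < pi" "0 < d" "d < min (pi / 2) (phase_diam N \<theta> 0)"
      "\<eta> > Max {1 / sin \<xi>, 1 / cos (R * T), 2 / (1 - \<zeta> / \<xi>)}" "\<beta> = 1 - 2 / \<eta>"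
      "c = ((\<Sum>j=1..N-1. \<eta> ^ j * num_perms (2 * N) j) + 1) * \<xi> / sin \<xi>"
      "tan (R * T) < \<beta> * d / ((1 + \<zeta> / (\<zeta> - D\<^sub>0)) * 2 * (real N - 1) * c)"
      "d + R * T < pi / 2"
      "\<kappa> > (1 + \<zeta> / (\<zeta> - D\<^sub>0)) *
             ((max_spread N \<Omega> + 2 * \<kappa> * sin (R * T)) * (real N - 1) * c / (2 * cos (R * T))) *
             (1 / (\<beta> * d))"
  define C where "C = 3 * R * exp (\<kappa> / 4 * (2 * T + ln 24 / (\<kappa> * (R * T))))"
  have delay_le: "\<tau> i j \<le> T" if "i \<in> {1..N}" "j \<in> {1..N}" for i j
    unfolding T max_delay_def using that by (intro Max_ge) auto
  have delay_nonneg: "0 \<le> \<tau> i j" if "i \<in> {1..N}" "j \<in> {1..N}" for i j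
    using delays that by (cases "i = j") (auto simp: less_imp_le)
  have "0 < \<tau> 1 2" using delays(1) \<open>2 \<le> N\<close> by simp
  then have "0 < T" using delay_le[of 1 2] \<open>2 \<le> N\<close> by simp
  interpret delayed_oscillators N \<Omega> \<kappa> \<tau> \<theta> T R "max_spread N \<Omega>"
  proof
    show "\<bar>\<Omega> i\<bar> + \<kappa> \<le> R" if "i \<in> {1..N}" for i
      unfolding R freq_bound_def using that by simp
    show "\<Omega> i - \<Omega> j \<le> max_spread N \<Omega>" if "i \<in> {1..N}" "j \<in> {1..N}" for i j
      using max_spread_le_iff[of N \<Omega> "max_spread N \<Omega>"] \<open>2 \<le> N\<close> that by simp
    show "continuous_on {0..} (\<theta> i)" if "i \<in> {1..N}" for i
    proof (rule continuous_on_subset)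
      show "continuous_on {- T..} (\<theta> i)"
        using solution that by (simp add: delayed_kuramoto_solution_def T)
    qed (use \<open>0 < T\<close> in auto)
  qed (use solution \<open>2 \<le> N\<close> \<open>0 < \<kappa>\<close> \<open>0 < T\<close> delay_le delay_nonneg in
      \<open>auto simp: delayed_kuramoto_solution_def\<close>)
  have initial: "\<theta> i 0 - \<theta> j 0 \<le> D\<^sub>0" if "i \<in> {1..N}" "j \<in> {1..N}" for i j
  proof -
    have "continuous_on {-T..0} (\<theta> i)" if "i \<in> {1..N}" for i
    proof (rule continuous_on_subset)
      show "continuous_on {- T..} (\<theta> i)"
        using solution that by (simp add: delayed_kuramoto_solution_def T)
    qed auto
    then have "\<bar>\<theta> i 0 - \<theta> j 0\<bar> \<le> D\<^sub>0"
      unfolding D\<^sub>0 using that \<open>0 < T\<close> by (intro initial_phase_difference_le) auto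
    then show ?thesis by simp
  qed
  have "phase_diam N \<theta> 0 \<le> D\<^sub>0"
    unfolding phase_diam_def using max_spread_le_iff[of N] initial \<open>2 \<le> N\<close> by simp
  then have d: "d < pi / 2" "d < D\<^sub>0" "0 \<le> D\<^sub>0"
    using parameters(4,5) by auto
  have "2 / (1 - \<zeta> / \<xi>) < \<eta>" using parameters(6) by simp
  note small = parameter_consequences[OF \<open>2 \<le> N\<close> \<open>0 < \<kappa>\<close> max_spread_nonneg _ d(3) parameters(1-4)
      d(1,2) this parameters(7-11)]
  have RT: "0 < R * T" "1 \<le> N" using R_pos \<open>0 < T\<close> \<open>2 \<le> N\<close> by auto
  \<comment> \<open>each of the two phases moves by at most \<open>R * T\<close> on \<open>{0..T}\<close>\<close>
  have start: "\<theta> i T - \<theta> j T < \<xi>" if "i \<in> {1..N}" "j \<in> {1..N}" for i j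
    using phase_lipschitz[of i 0 T] phase_lipschitz[of j 0 T] initial[OF that] small(1) RT that \<open>0 < T\<close>
    by (simp add: abs_le_iff)
  have "0 < \<xi>" using d parameters by simp
  have decay: "freq_diam N \<theta> t \<le> C * exp (- (\<kappa> / 4) * t)" if "0 < t" for t
    unfolding freq_diam_def max_spread_le_iff[OF \<open>1 \<le> N\<close>]
  proof (intro ballI)
    fix i j assume ij: "i \<in> {1..N}" "j \<in> {1..N}"
    have "frequency \<theta> k t = velocity k t" if "k \<in> {1..N}" for k
      using DERIV_imp_deriv[OF phase_deriv[OF that \<open>0 < t\<close>]] \<open>0 < t\<close> by (simp add: frequency_def)
    then show "frequency \<theta> i t - frequency \<theta> j t \<le> C * exp (- (\<kappa> / 4) * t)"
      using exponential_frequency_synchronization[OF \<open>0 < \<xi>\<close> \<open>\<xi> < pi\<close> start _ _ _ _ ij]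
        small(2-5) RT ij by (simp add: C_def mult.assoc)
  qed
  have "0 < C" using R_pos by (simp add: C_def)
  have "((\<lambda>t. C * exp (- (\<kappa> / 4) * t)) \<longlongrightarrow> 0) at_top"
  proof -
    have "filterlim (\<lambda>t. (\<kappa> / 4) * t) at_top at_top"
      using \<open>0 < \<kappa>\<close> by (intro filterlim_tendsto_pos_mult_at_top[OF tendsto_const _ filterlim_ident]) auto
    then have "filterlim (\<lambda>t. - (\<kappa> / 4) * t) at_bot at_top"
      by (simp add: filterlim_uminus_at_top)
    then have "((\<lambda>t. exp (- (\<kappa> / 4) * t)) \<longlongrightarrow> 0) at_top"
      by (rule filterlim_compose[OF exp_at_bot])
    then show ?thesis by (rule tendsto_mult_right_zero)
  qed
  then have limit: "(freq_diam N \<theta> \<longlongrightarrow> 0) at_top"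
  proof (rule tendsto_sandwich[OF _ _ tendsto_const, rotated 2])
    show "\<forall>\<^sub>F t in at_top. 0 \<le> freq_diam N \<theta> t"
      using max_spread_nonneg[OF \<open>1 \<le> N\<close>] by (simp add: freq_diam_def)
    show "\<forall>\<^sub>F t in at_top. freq_diam N \<theta> t \<le> C * exp (- (\<kappa> / 4) * t)"
      using eventually_gt_at_top[of 0] by eventually_elim (rule decay)
  qed
  \<comment> \<open>the frequency at time \<open>0\<close> comes from the initial data, whose speed \<open>R\<close> does not control, so \<open>C\<close> may have to be enlarged\<close>
  have closed: "\<exists>C'>0. \<forall>t\<ge>0. freq_diam N \<theta> t \<le> C' * exp (- (\<kappa> / 4) * t)"
  proof (intro exI[of _ "max C (freq_diam N \<theta> 0)"] conjI allI impI)
    fix t :: real assume "0 \<le> t"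
    show "freq_diam N \<theta> t \<le> max C (freq_diam N \<theta> 0) * exp (- (\<kappa> / 4) * t)"
    proof (cases "t = 0")
      case False
      then have "freq_diam N \<theta> t \<le> C * exp (- (\<kappa> / 4) * t)" using decay \<open>0 \<le> t\<close> by simp
      also have "\<dots> \<le> max C (freq_diam N \<theta> 0) * exp (- (\<kappa> / 4) * t)"
        by (intro mult_right_mono) auto
      finally show ?thesis .
    qed simp
  qed (use \<open>0 < C\<close> in simp)
  show "(freq_diam N \<theta> \<longlongrightarrow> 0) at_top \<and>
       0 < \<kappa> / 4 \<and> 0 < 3 * R * exp (\<kappa> / 4 * (2 * T + ln 24 / (\<kappa> * (R * T)))) \<and>
       (\<forall>t>0. freq_diam N \<theta> t \<le>
          3 * R * exp (\<kappa> / 4 * (2 * T + ln 24 / (\<kappa> * (R * T)))) * exp (- (\<kappa> / 4) * t)) \<and>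
       (\<exists>C'>0. \<forall>t\<ge>0. freq_diam N \<theta> t \<le> C' * exp (- (\<kappa> / 4) * t))"
    unfolding C_def[symmetric] using limit decay \<open>0 < C\<close> \<open>0 < \<kappa>\<close> closed by simp
qed

end
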